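(* Let $n,s,k$ be integers with $1\le s\le n$ and $k\ge 1$. Then $$p^1_{n;\le s;k}=p^2_{n;\le s;k}=\cdots=p^k_{n;\le s;k}.$$
   Context: Parking model: there are $n$ parking spaces in a line, numbered $1,\dots,n$. A preference set of length $n$ is a sequence $(a_1,\dots,a_n)$ of integers with $1\le a_i\le n$; cars $1,\dots,n$ arrive in order, car $i$ parks in the first unoccupied space numbered $\ge a_i$ if one exists, otherwise it fails to park. It is a $k$-flaw preference set if exactly $k$ cars fail to park. $p^l_{n;\le s;k}$ denotes the number of $k$-flaw preference sets $(a_1,\dots,a_n)$ of length $n$ with $n$ spaces such that $a_i\le s$ for all $i$ and $a_1=l$ (this is $0$ if $l>s$). *)

theory Defs
  imports Main
begin

text \<open>The preference set $(a_1,\dots,a_n)$ is the list \<open>[a\<^sub>1, \<dots>, a\<^sub>n]\<close>; cars are processed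
  from the head of the list.\<close>

definition preference_sets :: "nat \<Rightarrow> nat list set" where
  "preference_sets n = {as. length as = n \<and> set as \<subseteq> {1..n}}"

definition available :: "nat \<Rightarrow> nat set \<Rightarrow> nat \<Rightarrow> nat set" where
  "available n occ a = {j. a \<le> j \<and> j \<le> n \<and> j \<notin> occ}"

text \<open>Number of cars in the list that fail to park, when the spaces in \<open>occ\<close> are already
  taken.\<close>

fun failures :: "nat \<Rightarrow> nat set \<Rightarrow> nat list \<Rightarrow> nat" where
  "failures n occ [] = 0"
| "failures n occ (a # as) =
     (if available n occ a = {} then Suc (failures n occ as)
      else failures n (insert (Min (available n occ a)) occ) as)"

definition flaw_preference_sets :: "nat \<Rightarrow> nat \<Rightarrow> nat list set" where
  "flaw_preference_sets n k = {as \<in> preference_sets n. failures n {} as = k}"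

text \<open>\<open>num_flaw n s k l\<close> is $p^l_{n;\le s;k}$.\<close>

definition num_flaw :: "nat \<Rightarrow> nat \<Rightarrow> nat \<Rightarrow> nat \<Rightarrow> nat" where
  "num_flaw n s k l =
     card {as \<in> flaw_preference_sets n k. (\<forall>a \<in> set as. a \<le> s) \<and> hd as = l}"

end

theory Submission
  imports Defs
begin

text \<open>The number of failing cars is the maximum over \<open>j\<close> of the excess of cars preferring a
  space \<open>\<ge> j\<close> over the free spaces \<open>\<ge> j\<close>. With \<open>n\<close> cars and \<open>n\<close> spaces this excess is at most
  \<open>j - 1\<close>, so a threshold \<open>j \<le> k\<close> can never produce an excess of \<open>k\<close>. Moving the first car within
  \<open>{1..k}\<close> only affects such thresholds, hence preserves the property of having exactly \<open>k\<close> flaws,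
  and changing the first entry is a bijection.\<close>

definition num_ge :: "nat \<Rightarrow> nat list \<Rightarrow> nat" where
  "num_ge j as = length (filter (\<lambda>a. j \<le> a) as)"

lemma num_ge_simps [simp]:
  "num_ge j [] = 0"
  "num_ge j (a # as) = (if j \<le> a then Suc (num_ge j as) else num_ge j as)"
  by (simp_all add: num_ge_def)

lemma num_ge_antimono: "i \<le> j \<Longrightarrow> num_ge j as \<le> num_ge i as"
  by (induction as) auto

lemma num_ge_le_length: "num_ge j as \<le> length as"
  by (simp add: num_ge_def)

lemma num_ge_eq_0: "\<forall>a\<in>set as. a < j \<Longrightarrow> num_ge j as = 0"
  by (induction as) auto

lemma finite_available [simp]: "finite (available n occ a)"
  by (rule finite_subset[of _ "{..n}"]) (auto simp: available_def)

lemma available_antimono: "i \<le> j \<Longrightarrow> available n occ j \<subseteq> available n occ i"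
  by (auto simp: available_def)

lemma card_available_empty: "card (available n {} j) = Suc n - j"
proof -
  have "available n {} j = {j..n}" by (auto simp: available_def)
  then show ?thesis by simp
qed

lemma card_available_park:
  assumes "available n occ a \<noteq> {}"
  defines "p \<equiv> Min (available n occ a)"
  shows "card (available n occ j) =
    (if j \<le> p then Suc (card (available n (insert p occ) j)) else card (available n (insert p occ) j))"
proof -
  have p: "p \<in> available n occ a"
    unfolding p_def using assms(1) by (intro Min_in) auto
  show ?thesis
  proof (cases "j \<le> p")
    case True
    then have "available n occ j = insert p (available n (insert p occ) j)"
      using p by (auto simp: available_def)
    moreover have "p \<notin> available n (insert p occ) j" by (simp add: available_def)
    ultimately show ?thesis using True by simp
  next
    case False
    then have "available n occ j = available n (insert p occ) j"
      by (auto simp: available_def)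
    then show ?thesis using False by simp
  qed
qed

text \<open>A Hall-type condition. Both \<open>occ\<close> and \<open>k\<close> are generalised in
  the induction because a failing car lowers the allowance \<open>k\<close>, while a parking car
  enlarges \<open>occ\<close>.\<close>

lemma failures_le_iff:
  "failures n occ as \<le> k \<longleftrightarrow> (\<forall>j. num_ge j as \<le> k + card (available n occ j))"
proof (induction as arbitrary: occ k)
  case Nil
  show ?case by simp
next
  case (Cons a as)
  show ?case
  proof (cases "available n occ a = {}")
    case True
    show ?thesis
    proof (cases k)
      case 0
      \<comment> \<open>Threshold \<open>a\<close> refutes the right side: the car itself counts
        there and no space is free.\<close>
      have "\<not> num_ge a (a # as) \<le> k + card (available n occ a)"
        using 0 True by simp
      moreover have "\<not> failures n occ (a # as) \<le> k" using 0 True by simp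
      ultimately show ?thesis by blast
    next
      case (Suc k')
      have "(\<forall>j. num_ge j as \<le> k' + card (available n occ j)) \<longleftrightarrow>
          (\<forall>j. num_ge j (a # as) \<le> k + card (available n occ j))" (is "?L \<longleftrightarrow> ?R")
      proof
        assume ?L
        then show ?R using Suc by (simp add: le_SucI)
      next
        assume R: ?R
        show ?L
        proof
          fix j
          show "num_ge j as \<le> k' + card (available n occ j)"
          proof (cases "j \<le> a")
            case True
            then show ?thesis using spec[OF R, of j] Suc by simp
          next
            case False
            \<comment> \<open>Above \<open>a\<close> the car is not counted, so the saving of one is
              taken from threshold \<open>a\<close>, where nothing is free.\<close>
            then have "num_ge j as \<le> num_ge a as" by (simp add: num_ge_antimono)
            then show ?thesis using spec[OF R, of a] Suc True by simp
          qed
        qed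
      qed
      then show ?thesis using True Suc Cons.IH[of occ k'] by simp
    qed
  next
    case False
    define p where "p = Min (available n occ a)"
    define occ' where "occ' = insert p occ"
    have "p \<in> available n occ a"
      unfolding p_def using False by (intro Min_in) auto
    then have ap: "a \<le> p" by (simp add: available_def)
    have card: "card (available n occ j) =
        (if j \<le> p then Suc (card (available n occ' j)) else card (available n occ' j))" for j
      unfolding p_def occ'_def using card_available_park[OF False] by simp
    \<comment> \<open>\<open>p\<close> is the first free space from \<open>a\<close> on, so
      thresholds between \<open>a\<close> and \<open>p\<close> see the same free spaces.\<close>
    have gap: "available n occ j = available n occ a" if "a \<le> j" "j \<le> p" for j
    proof
      show "available n occ j \<subseteq> available n occ a" by (rule available_antimono) fact
      show "available n occ a \<subseteq> available n occ j"
      proof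
        fix x
        assume x: "x \<in> available n occ a"
        then have "p \<le> x" unfolding p_def by simp
        then show "x \<in> available n occ j" using x that(2) by (simp add: available_def)
      qed
    qed
    have "(\<forall>j. num_ge j as \<le> k + card (available n occ' j)) \<longleftrightarrow>
          (\<forall>j. num_ge j (a # as) \<le> k + card (available n occ j))" (is "?L \<longleftrightarrow> ?R")
    proof
      assume L: ?L
      show ?R
      proof
        fix j
        show "num_ge j (a # as) \<le> k + card (available n occ j)"
          using spec[OF L, of j] card[of j] ap by simp
      qed
    next
      assume R: ?R
      show ?L
      proof
        fix j
        consider "j \<le> a" | "a < j" "j \<le> p" | "p < j" by linarith
        then show "num_ge j as \<le> k + card (available n occ' j)"
        proof cases
          case 1
          then show ?thesis using spec[OF R, of j] card[of j] ap by simp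
        next
          case 2
          \<comment> \<open>Here parking removes a space without the car being counted; the bound at
            \<open>a\<close>, where it is counted, makes up for this by \<open>gap\<close>.\<close>
          then have "num_ge j as \<le> num_ge a as" by (simp add: num_ge_antimono)
          then show ?thesis
            using spec[OF R, of a] card[of a] card[of j] gap[of j] ap 2 by simp
        next
          case 3
          then show ?thesis using spec[OF R, of j] card[of j] ap by simp
        qed
      qed
    qed
    then show ?thesis using False Cons.IH[of occ' k] by (simp add: p_def occ'_def)
  qed
qed

text \<open>For \<open>j \<le> Suc k\<close> at least \<open>n - k\<close> spaces are free, so at
  most \<open>n\<close> cars cannot exceed the bound; for larger \<open>j\<close> neither
  \<open>l\<close> nor \<open>m\<close> is counted.\<close>

lemma failures_le_first_irrelevant:
  assumes "length as < n" "l \<le> Suc k" "m \<le> Suc k" "failures n {} (l # as) \<le> k"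
  shows "failures n {} (m # as) \<le> k"
  unfolding failures_le_iff
proof
  fix j
  show "num_ge j (m # as) \<le> k + card (available n {} j)"
  proof (cases "j \<le> Suc k")
    case True
    have "num_ge j (m # as) \<le> n"
      using num_ge_le_length[of j "m # as"] assms(1) by simp
    then show ?thesis using True by (simp add: card_available_empty)
  next
    case False
    then have "num_ge j (m # as) = num_ge j (l # as)" using assms(2,3) by simp
    then show ?thesis using assms(4) by (metis failures_le_iff)
  qed
qed

text \<open>Equality is split into \<open>\<le> k\<close> and not \<open>\<le> k - 1\<close>. The
  second half swaps \<open>l\<close> and \<open>m\<close> at \<open>k - 1\<close>, where the limit
  \<open>Suc (k - 1)\<close> is exactly the end of \<open>{1..k}\<close>.\<close>

lemma failures_eq_first_irrelevant:
  assumes "length as < n" "l \<in> {1..k}" "m \<in> {1..k}" "failures n {} (l # as) = k"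
  shows "failures n {} (m # as) = k"
proof -
  have "failures n {} (m # as) \<le> k"
    using assms by (intro failures_le_first_irrelevant[of as n l k m]) auto
  moreover have "\<not> failures n {} (m # as) \<le> k - 1"
  proof
    assume "failures n {} (m # as) \<le> k - 1"
    then have "failures n {} (l # as) \<le> k - 1"
      using assms(1-3) by (intro failures_le_first_irrelevant[of as n m "k - 1" l]) auto
    then show False using assms(2,4) by (simp del: failures.simps)
  qed
  ultimately show ?thesis by linarith
qed

text \<open>Ensures that a new first entry from \<open>{1..k}\<close> respects the bound
  \<open>s\<close>. A threshold with excess at least \<open>k\<close> lies above \<open>k\<close>,
  yet not above \<open>s\<close>, where no car is counted.\<close>

lemma flaws_less_bound:
  assumes "length as \<le> n" "\<forall>a\<in>set as. a \<le> s" "failures n {} as = k" "1 \<le> k"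
  shows "k < s"
proof -
  have "\<not> failures n {} as \<le> k - 1" using assms by simp
  then obtain j where j: "\<not> num_ge j as \<le> k - 1 + card (available n {} j)"
    unfolding failures_le_iff by blast
  then have "j \<le> s" using assms(2) num_ge_eq_0[of as j] by fastforce
  moreover have "num_ge j as \<le> n" using num_ge_le_length[of j as] assms(1) by simp
  ultimately show ?thesis using j assms(4) by (simp add: card_available_empty)
qed

text \<open>Overwriting the head by \<open>m\<close> is injective, since the old head is always
  \<open>l\<close>. One inequality suffices because \<open>l\<close> and \<open>m\<close> are
  interchangeable.\<close>

lemma num_flaw_le:
  assumes "s \<le> n" "1 \<le> n" "l \<in> {1..k}" "m \<in> {1..k}"
  shows "num_flaw n s k l \<le> num_flaw n s k m"
proof -
  let ?S = "\<lambda>l. {as \<in> flaw_preference_sets n k. (\<forall>a \<in> set as. a \<le> s) \<and> hd as = l}"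
  have "finite {as. set as \<subseteq> {1..n} \<and> length as = n}"
    by (rule finite_lists_length_eq) simp
  then have fin: "finite (?S m)"
    by (rule rev_finite_subset) (auto simp: flaw_preference_sets_def preference_sets_def)
  \<comment> \<open>Only for a nonempty list does \<open>hd as = l\<close> speak about an actual
    entry.\<close>
  have ne: "as \<noteq> []" if "as \<in> ?S l" for as
    using that assms(2) by (auto simp: flaw_preference_sets_def preference_sets_def)
  have inj: "inj_on (\<lambda>as. m # tl as) (?S l)"
  proof (rule inj_onI)
    fix as bs
    assume "as \<in> ?S l" "bs \<in> ?S l" "m # tl as = m # tl bs"
    then show "as = bs" using ne[of as] ne[of bs] by (auto intro: list.expand)
  qed
  have "(\<lambda>as. m # tl as) ` ?S l \<subseteq> ?S m"
  proof (rule image_subsetI)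
    fix as
    assume as: "as \<in> ?S l"
    then obtain bs where bs: "as = l # bs" using ne[OF as] by (cases as) auto
    have len: "length as = n" and rng: "set as \<subseteq> {1..n}" and fl: "failures n {} as = k"
      and le: "\<forall>a\<in>set as. a \<le> s"
      using as by (auto simp: flaw_preference_sets_def preference_sets_def)
    have "failures n {} (m # bs) = k"
      using failures_eq_first_irrelevant[of bs n l k m] len fl bs assms by simp
    moreover have "m \<le> s"
      using flaws_less_bound[of as n s k] len le fl assms by simp
    ultimately show "m # tl as \<in> ?S m"
      using len rng le bs assms by (simp add: flaw_preference_sets_def preference_sets_def)
  qed
  then show ?thesis
    unfolding num_flaw_def using card_inj_on_le[OF inj _ fin] by blast
qed

theorem theorem6p1:
  fixes n s k :: nat
  assumes "1 \<le> s" and "s \<le> n" and "1 \<le> k"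
  shows "\<forall>l \<in> {1..k}. \<forall>m \<in> {1..k}. num_flaw n s k l = num_flaw n s k m"
  using assms by (intro ballI antisym num_flaw_le) auto

end
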